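(* Let $\lambda>0$ and $0<h<\frac1\lambda$. Let $X_n^1,\dots,X_n^N\in\mathbb R^d$, $n\ge 0$, satisfy $$X_{n+1}^i=X_n^i+\lambda h\sum_{k=1}^N\psi_n^k(X_n^k-X_n^i),\qquad \psi_n^k:=\frac{e^{-\beta L(X_n^k)}}{\sum_{l=1}^Ne^{-\beta L(X_n^l)}},\qquad n=0,1,\dots,\ i=1,\dots,N,$$ with initial data $X_0^1,\dots,X_0^N\in\mathbb R^d$, and let $\mathcal D(\mathcal X_n):=\max_{1\le i,j\le N}|X_n^i-X_n^j|$. Then: (1) $\mathcal D(\mathcal X_n)\le e^{-\lambda nh}\mathcal D(\mathcal X_0)$ for all $n=0,1,\dots$; (2) there exists a unique $X_\infty\in\mathbb R^d$, independent of $i$, such that $\lim_{n\to\infty}X_n^i=X_\infty$ for all $i=1,\dots,N$.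
   Context: $N,d\ge1$, $\beta>0$; $L:\mathbb R^d\to\mathbb R$ is locally Lipschitz continuous; $|\cdot|$ is the Euclidean norm. (This is the discrete consensus-based optimization scheme with noise intensity $\sigma=0$.) *)

theory Defs
  imports "HOL-Analysis.Analysis"
begin

definition locally_lipschitz :: "('a::metric_space \<Rightarrow> 'b::metric_space) \<Rightarrow> bool" where
  "locally_lipschitz L \<longleftrightarrow> (\<forall>x. \<exists>u>0. \<exists>C. C-lipschitz_on (cball x u) L)"

(* The library notion local_lipschitz is for families of maps indexed by a metric space. *)
lemma locally_lipschitz_iff_local_lipschitz:
  "locally_lipschitz L \<longleftrightarrow> local_lipschitz (UNIV :: real set) UNIV (\<lambda>_. L)"
proof
  assume "locally_lipschitz L"
  then show "local_lipschitz (UNIV :: real set) UNIV (\<lambda>_. L)"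
    unfolding locally_lipschitz_def local_lipschitz_def by simp blast
next
  assume R: "local_lipschitz (UNIV :: real set) UNIV (\<lambda>_. L)"
  show "locally_lipschitz L"
    unfolding locally_lipschitz_def
  proof
    fix x
    from R obtain u C where u: "u > 0"
      and C: "\<forall>t\<in>cball (0::real) u \<inter> UNIV. C-lipschitz_on (cball x u \<inter> UNIV) L"
      unfolding local_lipschitz_def by blast
    from u have "(0::real) \<in> cball 0 u \<inter> UNIV" by simp
    with C have "C-lipschitz_on (cball x u) L" by fastforce
    with u show "\<exists>u>0. \<exists>C. C-lipschitz_on (cball x u) L" by blast
  qed
qed

(* A configuration x of N agents assigns a position to each index in {1..N}; its values at
   other indices are irrelevant. *)

definition cbo_weight :: "real \<Rightarrow> ('a \<Rightarrow> real) \<Rightarrow> nat \<Rightarrow> (nat \<Rightarrow> 'a) \<Rightarrow> nat \<Rightarrow> real" where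
  "cbo_weight \<beta> L N x k = exp (- \<beta> * L (x k)) / (\<Sum>l=1..N. exp (- \<beta> * L (x l)))"

definition config_diameter :: "nat \<Rightarrow> (nat \<Rightarrow> 'a::real_normed_vector) \<Rightarrow> real" where
  "config_diameter N x = Max {norm (x i - x j) | i j. i \<in> {1..N} \<and> j \<in> {1..N}}"

end

theory Submission
  imports Defs
begin

text \<open>Since the weights sum to 1, all agents are attracted to the same weighted mean, which cancels
  in differences: \<open>X (Suc n) i - X (Suc n) j = (1 - lam * h) *\<^sub>R (X n i - X n j)\<close>. Hence every
  difference decays geometrically with ratio \<open>1 - lam * h \<le> exp (- lam * h)\<close>. The increments of each
  trajectory are averages of differences, hence summable, so each trajectory converges, and the
  limits coincide.\<close>

lemma cbo_weight_nonneg: "0 \<le> cbo_weight \<beta> L N x k"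
  by (simp add: cbo_weight_def sum_nonneg)

lemma sum_cbo_weight:
  assumes "N \<ge> 1"
  shows "(\<Sum>k=1..N. cbo_weight \<beta> L N x k) = 1"
proof -
  have "(\<Sum>l=1..N. exp (- \<beta> * L (x l))) > 0"
    using assms by (intro sum_pos) auto
  then show ?thesis
    by (simp add: cbo_weight_def flip: sum_divide_distrib)
qed

lemma finite_config_distances:
  "finite {norm (x i - x j :: 'a::real_normed_vector) | i j. i \<in> {1..N::nat} \<and> j \<in> {1..N}}"
  by (rule finite_subset[of _ "(\<lambda>(i, j). norm (x i - x j)) ` ({1..N} \<times> {1..N})"]) auto

lemma norm_le_config_diameter:
  assumes "i \<in> {1..N}" "j \<in> {1..N}"
  shows "norm (x i - x j) \<le> config_diameter N x"
  unfolding config_diameter_def using assms finite_config_distances by (intro Max_ge) auto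

lemma config_diameter_le:
  assumes "N \<ge> 1" "\<And>i j. i \<in> {1..N} \<Longrightarrow> j \<in> {1..N} \<Longrightarrow> norm (x i - x j) \<le> C"
  shows "config_diameter N x \<le> C"
proof -
  \<comment> \<open>Nonemptiness of the set of distances, without which its \<open>Max\<close> would
    be an unspecified value; the index 1 is available because \<open>N \<ge> 1\<close>.\<close>
  have "norm (x 1 - x 1) \<in> {norm (x i - x j) | i j. i \<in> {1..N} \<and> j \<in> {1..N}}"
    using assms(1) by auto
  then show ?thesis
    unfolding config_diameter_def using assms(2) finite_config_distances
    by (subst Max_le_iff) blast+
qed

lemma config_diameter_nonneg:
  assumes "N \<ge> 1"
  shows "0 \<le> config_diameter N x"
  using norm_le_config_diameter[of 1 N 1 x] assms by simp

text \<open>The partial sums of the increments telescope to \<open>f n - f 0\<close>. Completeness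
  of the space does not enter here, only where summability is deduced from a bound on norms.\<close>

lemma convergent_of_summable_increments:
  fixes f :: "nat \<Rightarrow> 'a::real_normed_vector"
  assumes "summable (\<lambda>n. f (Suc n) - f n)"
  shows "convergent f"
proof -
  have "(\<lambda>n. \<Sum>k<n. f (Suc k) - f k) \<longlonglongrightarrow> (\<Sum>n. f (Suc n) - f n)"
    using assms by (rule summable_LIMSEQ)
  then have "(\<lambda>n. f n - f 0 + f 0) \<longlonglongrightarrow> (\<Sum>n. f (Suc n) - f n) + f 0"
    unfolding sum_lessThan_telescope by (intro tendsto_intros)
  then show ?thesis
    by (auto simp: convergent_def)
qed

text \<open>An exact identity rather than a norm estimate, because it serves twice: for the
  geometric bound on the distances and for carrying the limit of one agent over to the others. The
  size of \<open>c\<close> matters only once norms or limits are taken.\<close>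

lemma cbo_difference:
  fixes X :: "nat \<Rightarrow> nat \<Rightarrow> 'a::real_normed_vector"
  assumes "N \<ge> 1"
    and step: "\<And>n i. i \<in> {1..N} \<Longrightarrow>
      X (Suc n) i = X n i + c *\<^sub>R (\<Sum>k=1..N. cbo_weight \<beta> L N (X n) k *\<^sub>R (X n k - X n i))"
    and i: "i \<in> {1..N}" and j: "j \<in> {1..N}"
  shows "X n i - X n j = (1 - c) ^ n *\<^sub>R (X 0 i - X 0 j)"
proof (induction n)
  case (Suc n)
  \<comment> \<open>The weights depend on the configuration but not on the agent being moved, so
    \<open>m\<close> is common to all agents and cancels in differences.\<close>
  define m where "m = (\<Sum>k=1..N. cbo_weight \<beta> L N (X n) k *\<^sub>R X n k)"
  have step': "X (Suc n) i = X n i + c *\<^sub>R (m - X n i)" if "i \<in> {1..N}" for i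
    unfolding step[OF that]
    by (simp add: m_def scaleR_diff_right sum_subtractf sum_cbo_weight[OF \<open>N \<ge> 1\<close>]
        del: One_nat_def flip: scaleR_sum_left)
  have "X (Suc n) i - X (Suc n) j = (1 - c) *\<^sub>R (X n i - X n j)"
    by (simp add: step'[OF i] step'[OF j] algebra_simps)
  with Suc show ?case
    by simp
qed simp

theorem theorem3p3:
  fixes N :: nat and \<beta> lam h :: real
    and L :: "real ^ 'd \<Rightarrow> real"
    and X :: "nat \<Rightarrow> nat \<Rightarrow> real ^ 'd"
  assumes "N \<ge> 1" and "\<beta> > 0" and "locally_lipschitz L"
    and "lam > 0" and "0 < h" and "h < 1 / lam"
    and "\<And>n i. i \<in> {1..N} \<Longrightarrow>
      X (Suc n) i = X n i + (lam * h) *\<^sub>R (\<Sum>k=1..N. cbo_weight \<beta> L N (X n) k *\<^sub>R (X n k - X n i))"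
  shows "(\<forall>n. config_diameter N (X n) \<le> exp (- lam * real n * h) * config_diameter N (X 0))
    \<and> (\<exists>!X_inf. \<forall>i\<in>{1..N}. (\<lambda>n. X n i) \<longlonglongrightarrow> X_inf)"
proof -
  define q where "q = 1 - lam * h"
  define D where "D = config_diameter N (X 0)"
  \<comment> \<open>Positivity, from \<open>h < 1 / lam\<close>, lets \<open>norm\<close> and
    \<open>power_mono\<close> handle powers of \<open>q\<close> without absolute values;
    \<open>q < 1\<close> makes the geometric series converge.\<close>
  have q: "0 < q" "q < 1"
    using assms(4-6) by (auto simp: q_def field_simps)
  have D: "0 \<le> D"
    unfolding D_def using assms(1) by (rule config_diameter_nonneg)
  have diff: "X n i - X n j = q ^ n *\<^sub>R (X 0 i - X 0 j)"
    if "i \<in> {1..N}" "j \<in> {1..N}" for n i j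
    unfolding q_def using assms(1,7) that by (rule cbo_difference)
  have bound: "norm (X n i - X n j) \<le> q ^ n * D" if "i \<in> {1..N}" "j \<in> {1..N}" for n i j
    unfolding diff[OF that, of n] D_def
    using q norm_le_config_diameter[OF that, of "X 0"] by (simp add: mult_left_mono)
  have "q ^ n \<le> exp (- lam * real n * h)" for n
  proof -
    \<comment> \<open>The inequality \<open>1 + x \<le> exp x\<close> at
      \<open>x = - (lam * h)\<close>, raised to the power \<open>n\<close>.\<close>
    have "q ^ n \<le> exp (- (lam * h)) ^ n"
      using q exp_ge_add_one_self[of "- (lam * h)"] by (intro power_mono) (auto simp: q_def)
    also have "\<dots> = exp (- lam * real n * h)"
      by (simp add: mult_ac flip: exp_of_nat_mult)
    finally show ?thesis .
  qed
  then have decay: "config_diameter N (X n) \<le> exp (- lam * real n * h) * D" for n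
    using assms(1) bound D by (meson config_diameter_le mult_right_mono order_trans)
  have "convergent (\<lambda>n. X n i)" if i: "i \<in> {1..N}" for i
  proof (rule convergent_of_summable_increments, rule summable_comparison_test')
    \<comment> \<open>An increment is \<open>lam * h\<close> times a weighted average of
      differences, each of norm at most \<open>q ^ n * D\<close>; this gives the dominating
      series.\<close>
    show "summable (\<lambda>n. lam * h * D * q ^ n)"
      using q by (intro summable_mult summable_geometric) auto
    fix n
    have "norm (\<Sum>k=1..N. cbo_weight \<beta> L N (X n) k *\<^sub>R (X n k - X n i))
        \<le> (\<Sum>k=1..N. cbo_weight \<beta> L N (X n) k * (q ^ n * D))"
      using bound i by (intro sum_norm_le) (auto simp: cbo_weight_nonneg intro!: mult_left_mono)
    also have "\<dots> = q ^ n * D"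
      by (simp add: sum_cbo_weight[OF assms(1)] del: One_nat_def flip: sum_distrib_right)
    finally show "norm (X (Suc n) i - X n i) \<le> lam * h * D * q ^ n"
      using assms(4,5) by (simp add: assms(7)[OF i] mult_ac)
  qed
  then obtain x where x: "(\<lambda>n. X n 1) \<longlonglongrightarrow> x"
    using assms(1) by (auto simp: convergent_def)
  have lim: "(\<lambda>n. X n i) \<longlonglongrightarrow> x" if "i \<in> {1..N}" for i
  proof -
    \<comment> \<open>Agent 1 serves as reference: agent \<open>i\<close> differs from it by a fixed
      vector scaled by \<open>q ^ n\<close>, which vanishes in the limit.\<close>
    have "(\<lambda>n. q ^ n *\<^sub>R (X 0 i - X 0 1) + X n 1) \<longlonglongrightarrow> 0 *\<^sub>R (X 0 i - X 0 1) + x"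
      using q x by (intro tendsto_intros LIMSEQ_power_zero) auto
    moreover have "q ^ n *\<^sub>R (X 0 i - X 0 1) + X n 1 = X n i" for n
      using diff[of i 1 n, symmetric] that assms(1) by simp
    ultimately show ?thesis
      by simp
  qed
  have "\<exists>!x. \<forall>i\<in>{1..N}. (\<lambda>n. X n i) \<longlonglongrightarrow> x"
  proof (rule ex1I[of _ x])
    fix y
    assume "\<forall>i\<in>{1..N}. (\<lambda>n. X n i) \<longlonglongrightarrow> y"
    \<comment> \<open>Uniqueness rests on there being at least one agent; for an empty index set
      every \<open>y\<close> would qualify.\<close>
    then have "(\<lambda>n. X n 1) \<longlonglongrightarrow> y"
      using assms(1) by auto
    then show "y = x"
      using x by (rule LIMSEQ_unique)
  qed (use lim in blast)
  then show ?thesis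
    using decay unfolding D_def by blast
qed

end
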